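(* For any given $G=\frac{4c_f}{c_a}$, the zero gain threshold $f^*(G)$ exists and satisfies $$1<f^*(G)<2.$$
   Context: Here $c_f>0$ is the cost of fetching an item from a database to a cache and $c_a\ge0$ is the aging cost coefficient. For a single item with popularity $p$, update rate $\lambda$ and total request rate $\beta$, the optimal push-based cost (under an integrality assumption on $\sqrt{2\lambda c_f/(\beta pc_a)}$) is $C^{B^*}=\sqrt{2\lambda\beta pc_ac_f}-\frac12\beta pc_a$ and the optimal pull-based cost is $C^{E^*}=\lambda c_a\Big(\sqrt{1+\frac{2\beta pc_f}{\lambda c_a}}-1\Big)$. The percentage cost reduction is $$\mathrm{Reduction}(\%)=100\times\frac{C^{E^*}-C^{B^*}}{C^{B^*}}=100\times\left(\frac{\sqrt{1+GF}-1}{\sqrt{GF}-F}-1\right),\qquad F=\frac{\beta p}{2\lambda},\quad G=\frac{4c_f}{c_a}.$$ The zero gain threshold is $f^*(G)=\{2F\mid\mathrm{Reduction}(\%)=0\}$, i.e. the value of $2F=\beta p/\lambda$, for the given $G$, at which the reduction is zero.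
   Formalization: The lower bound 1 < f*(G) is claimed only for G > 9/8 or when the integrality assumption holds at the threshold, since it fails for smaller G (f*(9/8) = 1); existence, uniqueness and f*(G) < 2 are stated for every G > 0. *)

theory Defs
  imports Complex_Main
begin

text \<open>
  Parameters, in this order throughout: update rate \<open>l\<close>, total request rate \<open>b\<close>, popularity \<open>p\<close>,
  fetching cost \<open>cf\<close>, aging cost coefficient \<open>ca\<close>.
\<close>

definition admissible :: "real \<Rightarrow> real \<Rightarrow> real \<Rightarrow> real \<Rightarrow> real \<Rightarrow> bool" where
  "admissible l b p cf ca \<longleftrightarrow> 0 < l \<and> 0 < b \<and> 0 < p \<and> p \<le> 1 \<and> 0 < cf \<and> 0 < ca"

text \<open>
  The closed form \<open>push_cost\<close> is the minimum of \<open>b * p * ca * (m - 1) / 2 + l * cf / m\<close> over real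
  \<open>m > 0\<close>. It is attained at \<open>m = push_period l b p cf ca\<close>, hence it is also the minimum over integers
  \<open>m \<ge> 1\<close> when that number is an integer.
\<close>

definition push_period :: "real \<Rightarrow> real \<Rightarrow> real \<Rightarrow> real \<Rightarrow> real \<Rightarrow> real" where
  "push_period l b p cf ca = sqrt (2 * l * cf / (b * p * ca))"

definition push_cost :: "real \<Rightarrow> real \<Rightarrow> real \<Rightarrow> real \<Rightarrow> real \<Rightarrow> real" where
  "push_cost l b p cf ca = sqrt (2 * l * b * p * ca * cf) - 1 / 2 * b * p * ca"

definition pull_cost :: "real \<Rightarrow> real \<Rightarrow> real \<Rightarrow> real \<Rightarrow> real \<Rightarrow> real" where
  "pull_cost l b p cf ca = l * ca * (sqrt (1 + 2 * b * p * cf / (l * ca)) - 1)"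

definition reduction :: "real \<Rightarrow> real \<Rightarrow> real \<Rightarrow> real \<Rightarrow> real \<Rightarrow> real" where
  "reduction l b p cf ca =
     100 * ((pull_cost l b p cf ca - push_cost l b p cf ca) / push_cost l b p cf ca)"

text \<open>
  The values of \<open>2 * F = b * p / l\<close> at which the reduction vanishes, for a given \<open>G\<close>. The condition
  \<open>push_cost \<noteq> 0\<close> only says that the quotient is meaningful: without it the convention
  \<open>x / 0 = 0\<close> would add the spurious point \<open>F = G\<close>.
\<close>

definition zero_gain_points :: "real \<Rightarrow> real set" where
  "zero_gain_points G =
     {b * p / l | l b p cf ca.
        admissible l b p cf ca \<and> 4 * cf / ca = G \<and>
        push_cost l b p cf ca \<noteq> 0 \<and> reduction l b p cf ca = 0}"

definition zero_gain_threshold :: "real \<Rightarrow> real" where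
  "zero_gain_threshold G = (THE f. f \<in> zero_gain_points G)"

lemma push_cost_eq:
  assumes "admissible l b p cf ca"
  defines "F \<equiv> b * p / (2 * l)" and "G \<equiv> 4 * cf / ca"
  shows "push_cost l b p cf ca = l * ca * (sqrt (G * F) - F)"
proof -
  have pos: "0 < l" "0 < ca" using assms(1) by (auto simp: admissible_def)
  have "2 * l * b * p * ca * cf = (l * ca)\<^sup>2 * (G * F)"
    using pos by (simp add: F_def G_def field_simps power2_eq_square)
  then have "sqrt (2 * l * b * p * ca * cf) = l * ca * sqrt (G * F)"
    using pos by (simp add: real_sqrt_mult)
  moreover have "1 / 2 * b * p * ca = l * ca * F"
    using pos by (simp add: F_def field_simps)
  ultimately show ?thesis by (simp only: push_cost_def right_diff_distrib)
qed

lemma pull_cost_eq: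
  assumes "admissible l b p cf ca"
  defines "F \<equiv> b * p / (2 * l)" and "G \<equiv> 4 * cf / ca"
  shows "pull_cost l b p cf ca = l * ca * (sqrt (1 + G * F) - 1)"
proof -
  have pos: "0 < l" "0 < ca" using assms(1) by (auto simp: admissible_def)
  have "2 * b * p * cf / (l * ca) = G * F"
    using pos by (simp add: F_def G_def field_simps)
  then show ?thesis by (simp add: pull_cost_def)
qed

lemma reduction_eq:
  assumes "admissible l b p cf ca" and "push_cost l b p cf ca \<noteq> 0"
  defines "F \<equiv> b * p / (2 * l)" and "G \<equiv> 4 * cf / ca"
  shows "reduction l b p cf ca = 100 * ((sqrt (1 + G * F) - 1) / (sqrt (G * F) - F) - 1)"
proof -
  have pos: "l * ca \<noteq> 0" using assms(1) by (auto simp: admissible_def)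
  have B: "push_cost l b p cf ca = l * ca * (sqrt (G * F) - F)"
    and E: "pull_cost l b p cf ca = l * ca * (sqrt (1 + G * F) - 1)"
    using push_cost_eq[OF assms(1)] pull_cost_eq[OF assms(1)] by (simp_all add: F_def G_def)
  have "reduction l b p cf ca
      = 100 * (pull_cost l b p cf ca / push_cost l b p cf ca - 1)"
    using assms(2) by (simp add: reduction_def diff_divide_distrib)
  also have "pull_cost l b p cf ca / push_cost l b p cf ca
      = (sqrt (1 + G * F) - 1) / (sqrt (G * F) - F)"
    unfolding B E using pos by simp
  finally show ?thesis .
qed

text \<open>
  The lower bound \<open>1 < zero_gain_threshold G\<close> cannot hold for every \<open>G > 0\<close>: at \<open>G = 9 / 8\<close> the
  reduction vanishes at \<open>F = 1 / 2\<close>, that is at \<open>2 * F = 1\<close>. The push period there is \<open>3 / 4\<close>.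
\<close>

lemma one_mem_zero_gain_points: "1 \<in> zero_gain_points (9 / 8)"
proof -
  have adm: "admissible 1 1 1 9 32" by (simp add: admissible_def)
  have "sqrt (576::real) = 24" "sqrt (25 / 16 :: real) = 5 / 4"
    by (rule real_sqrt_unique; simp add: power2_eq_square)+
  then have "push_cost 1 1 1 9 32 = 8" "pull_cost 1 1 1 9 32 = 8"
    by (simp_all add: push_cost_def pull_cost_def)
  then show ?thesis
    unfolding zero_gain_points_def mem_Collect_eq using adm
    by (intro exI[of _ "1::real"] exI[of _ "9::real"] exI[of _ "32::real"] exI conjI)
       (simp_all add: reduction_def)
qed

end

theory Submission
  imports Defs
begin

text \<open>
  Write \<open>F = b * p / (2 * l)\<close>. The reduction vanishes iff
  \<open>sqrt (1 + G * F) - sqrt (G * F) = 1 - F\<close>. Since the product of this difference with the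
  corresponding sum is \<open>1\<close>, this determines \<open>sqrt (G * F)\<close> and gives
  \<open>G = F * (2 - F)\<^sup>2 / (4 * (1 - F)\<^sup>2)\<close> with \<open>0 < F < 1\<close>. The right-hand side increases
  strictly from \<open>0\<close> to infinity and equals \<open>9 / 8\<close> at \<open>F = 1 / 2\<close>. At the solution the push
  period is \<open>(2 - F) / (4 * (1 - F))\<close>, which is at least \<open>1\<close> only if \<open>F \<ge> 2 / 3\<close>.
\<close>

definition balance_gain :: "real \<Rightarrow> real" where
  "balance_gain F = F * (2 - F)\<^sup>2 / (4 * (1 - F)\<^sup>2)"

text \<open>On \<open>0 < z < 1\<close> the quotient
  \<open>(2 - z) / (1 - z) = 1 + 1 / (1 - z)\<close> is positive and increasing, hence so is its
  square times \<open>z\<close>.\<close>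

lemma balance_gain_strict_mono:
  assumes "0 < x" "x < y" "y < 1"
  shows "balance_gain x < balance_gain y"
proof -
  have "(2 - x) / (1 - x) < (2 - y) / (1 - y)"
    using assms by (simp add: field_simps)
  then have "((2 - x) / (1 - x))\<^sup>2 < ((2 - y) / (1 - y))\<^sup>2"
    using assms by (intro power_strict_mono) auto
  then have "x * ((2 - x) / (1 - x))\<^sup>2 < y * ((2 - y) / (1 - y))\<^sup>2"
    using assms by (intro mult_strict_mono) auto
  moreover have "balance_gain z = z * ((2 - z) / (1 - z))\<^sup>2 / 4" for z
    by (simp add: balance_gain_def power_divide)
  ultimately show ?thesis
    by (simp only: divide_strict_right_mono zero_less_numeral)
qed

lemma ex_balance_gain_eq:
  assumes "0 < G"
  obtains F where "0 < F" "F < 1" "balance_gain F = G"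
proof -
  \<comment> \<open>Clearing the denominator removes the pole at \<open>F = 1\<close>. The signs at
    the ends differ: \<open>q 0 = - 4 * G\<close> and \<open>q 1 = 1\<close>.\<close>
  define q where "q F = F * (2 - F)\<^sup>2 - 4 * G * (1 - F)\<^sup>2" for F
  have "continuous_on {0..1} q"
    unfolding q_def by (intro continuous_intros)
  then obtain F where F: "0 \<le> F" "F \<le> 1" "q F = 0"
    using IVT'[of q 0 0 1] assms by (auto simp: q_def)
  have "F \<noteq> 0" "F \<noteq> 1"
    using F(3) assms by (auto simp: q_def)
  moreover from this F(3) have "balance_gain F = G"
    by (simp add: balance_gain_def q_def field_simps)
  ultimately show thesis
    using that[of F] F by simp
qed

lemma sqrt_balance_iff:
  assumes "0 < F" "0 < G"
  shows "sqrt (1 + G * F) - 1 = sqrt (G * F) - F \<longleftrightarrow> F < 1 \<and> balance_gain F = G"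
proof
  assume eq: "sqrt (1 + G * F) - 1 = sqrt (G * F) - F"
  have "sqrt (G * F) < sqrt (1 + G * F)"
    by simp
  with eq have "F < 1"
    by linarith
  \<comment> \<open>Squaring with \<open>1 - F\<close> on the right cancels \<open>G * F\<close> and
    leaves an equation linear in \<open>sqrt (G * F)\<close>.\<close>
  have "1 + G * F = (sqrt (1 + G * F))\<^sup>2"
    using assms by simp
  also have "\<dots> = (sqrt (G * F) + (1 - F))\<^sup>2"
    using eq by (intro arg_cong[where f = "\<lambda>x. x\<^sup>2"]) linarith
  also have "\<dots> = G * F + 2 * sqrt (G * F) * (1 - F) + (1 - F)\<^sup>2"
    using assms by (simp add: power2_sum)
  finally have "2 * sqrt (G * F) * (1 - F) = F * (2 - F)"
    by (simp add: power2_eq_square algebra_simps)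
  then have "(2 * sqrt (G * F) * (1 - F))\<^sup>2 = (F * (2 - F))\<^sup>2"
    by simp
  then have "F * (4 * G * (1 - F)\<^sup>2) = F * (F * (2 - F)\<^sup>2)"
    using assms by (simp add: power_mult_distrib power2_eq_square[of F] mult_ac)
  then have "4 * G * (1 - F)\<^sup>2 = F * (2 - F)\<^sup>2"
    using assms by simp
  with \<open>F < 1\<close> show "F < 1 \<and> balance_gain F = G"
    by (simp add: balance_gain_def field_simps)
next
  assume F: "F < 1 \<and> balance_gain F = G"
  \<comment> \<open>The value that the linear equation of the other direction forces on
    \<open>sqrt (G * F)\<close>. Both squarings can be undone because \<open>s\<close> and
    \<open>1 - F\<close> are nonnegative.\<close>
  define s where "s = F * (2 - F) / (2 * (1 - F))"
  have "0 \<le> s"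
    using F assms by (simp add: s_def)
  have GF: "G * F = s\<^sup>2"
    using F by (auto simp: s_def balance_gain_def power2_eq_square simp del: right_diff_distrib_numeral)
  have "2 * s * (1 - F) = F * (2 - F)"
    using F by (simp add: s_def del: right_diff_distrib_numeral)
  then have "1 + G * F = (s + (1 - F))\<^sup>2"
    unfolding GF by (simp add: power2_eq_square algebra_simps)
  then have "sqrt (1 + G * F) = s + (1 - F)"
    using \<open>0 \<le> s\<close> F by simp
  moreover have "sqrt (G * F) = s"
    using \<open>0 \<le> s\<close> GF by simp
  ultimately show "sqrt (1 + G * F) - 1 = sqrt (G * F) - F"
    by simp
qed

lemma zero_gain_iff:
  assumes "admissible l b p cf ca"
  shows "push_cost l b p cf ca \<noteq> 0 \<and> reduction l b p cf ca = 0 \<longleftrightarrow>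
    b * p / (2 * l) < 1 \<and> balance_gain (b * p / (2 * l)) = 4 * cf / ca"
proof -
  let ?F = "b * p / (2 * l)" and ?G = "4 * cf / ca"
  have pos: "0 < l * ca" "0 < ?F" "0 < ?G"
    using assms by (auto simp: admissible_def)
  \<comment> \<open>As the pull cost is positive, equal costs already force \<open>push_cost\<close>
    to be nonzero, so the case \<open>x / 0 = 0\<close> cannot interfere.\<close>
  have "1 < sqrt (1 + ?G * ?F)"
    using mult_pos_pos[OF pos(3,2)] by simp
  then have "0 < pull_cost l b p cf ca"
    using pos by (simp add: pull_cost_eq[OF assms] del: times_divide_eq_left times_divide_eq_right)
  then have "push_cost l b p cf ca \<noteq> 0 \<and> reduction l b p cf ca = 0 \<longleftrightarrow>
      pull_cost l b p cf ca = push_cost l b p cf ca"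
    by (auto simp: reduction_def)
  also have "\<dots> \<longleftrightarrow> sqrt (1 + ?G * ?F) - 1 = sqrt (?G * ?F) - ?F"
    unfolding pull_cost_eq[OF assms] push_cost_eq[OF assms] using pos(1)
    by (subst mult_cancel_left) auto
  finally show ?thesis
    using sqrt_balance_iff[OF pos(2,3)] by simp
qed

lemma mem_zero_gain_points_iff:
  assumes "0 < G"
  shows "f \<in> zero_gain_points G \<longleftrightarrow> 0 < f \<and> f < 2 \<and> balance_gain (f / 2) = G"
proof
  assume "f \<in> zero_gain_points G"
  then obtain l b p cf ca where adm: "admissible l b p cf ca" and f: "f = b * p / l"
    and G: "4 * cf / ca = G"
    and zero: "push_cost l b p cf ca \<noteq> 0 \<and> reduction l b p cf ca = 0"
    unfolding zero_gain_points_def by blast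
  have F: "b * p / (2 * l) = f / 2" and "0 < f"
    using adm by (simp_all add: f admissible_def)
  then show "0 < f \<and> f < 2 \<and> balance_gain (f / 2) = G"
    using zero G unfolding zero_gain_iff[OF adm] F by simp
next
  assume f: "0 < f \<and> f < 2 \<and> balance_gain (f / 2) = G"
  \<comment> \<open>Only the ratios \<open>b * p / l\<close> and \<open>4 * cf / ca\<close> matter,
    so the parameters are chosen to make them \<open>f\<close> and \<open>G\<close>, with
    \<open>p = 1\<close> permitted.\<close>
  have adm: "admissible 1 f 1 G 4"
    using assms f by (simp add: admissible_def)
  moreover have "push_cost 1 f 1 G 4 \<noteq> 0 \<and> reduction 1 f 1 G 4 = 0"
    unfolding zero_gain_iff[OF adm] using f by simp
  ultimately show "f \<in> zero_gain_points G"
    unfolding zero_gain_points_def mem_Collect_eq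
    by (intro exI[of _ "1::real"] exI[of _ f] exI[of _ G] exI[of _ "4::real"]) simp
qed

text \<open>This makes the description in \<open>zero_gain_threshold\<close> well defined.\<close>

lemma ex1_zero_gain_point:
  assumes "0 < G"
  shows "\<exists>!f. f \<in> zero_gain_points G"
proof (rule ex_ex1I)
  obtain F where "0 < F" "F < 1" "balance_gain F = G"
    using ex_balance_gain_eq[OF assms] .
  then have "2 * F \<in> zero_gain_points G"
    by (simp add: mem_zero_gain_points_iff[OF assms])
  then show "\<exists>f. f \<in> zero_gain_points G" ..
next
  fix f g assume "f \<in> zero_gain_points G" "g \<in> zero_gain_points G"
  then show "f = g"
    using balance_gain_strict_mono[of "f / 2" "g / 2"] balance_gain_strict_mono[of "g / 2" "f / 2"]
    by (cases f g rule: linorder_cases) (auto simp: mem_zero_gain_points_iff[OF assms])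
qed

text \<open>The period is \<open>sqrt (G / (4 * F))\<close>, and on the zero gain curve the radicand
  is a perfect square. This turns integrality of the period into a bound on
  \<open>F\<close>.\<close>

lemma push_period_balance_gain:
  assumes "admissible l b p cf ca"
  defines "F \<equiv> b * p / (2 * l)"
  assumes "F < 1" "balance_gain F = 4 * cf / ca"
  shows "push_period l b p cf ca = (2 - F) / (4 * (1 - F))"
proof -
  have "0 < F"
    using assms(1) by (simp add: F_def admissible_def)
  have "2 * l * cf / (b * p * ca) = 4 * cf / ca / (4 * F)"
    using assms(1) by (simp add: F_def admissible_def field_simps)
  also have "\<dots> = ((2 - F) / (4 * (1 - F)))\<^sup>2"
    using \<open>0 < F\<close> by (simp add: assms(4)[symmetric] balance_gain_def power2_eq_square
        del: right_diff_distrib_numeral)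
  finally show ?thesis
    using \<open>F < 1\<close> by (simp add: push_period_def)
qed

text \<open>By monotonicity the threshold is at most \<open>1\<close> when
  \<open>G \<le> 9 / 8\<close>. The lower bound is therefore tied either to larger \<open>G\<close>
  or to the integrality behind the push cost formula.\<close>

theorem proposition1:
  fixes cf ca G :: real
  assumes "0 < cf" and "0 < ca" and "G = 4 * cf / ca"
  shows "(\<exists>!f. f \<in> zero_gain_points G)
    \<and> zero_gain_threshold G < 2
    \<and> (9 / 8 < G \<longrightarrow> 1 < zero_gain_threshold G)
    \<and> (\<forall>l b p. admissible l b p cf ca \<and> b * p / l = zero_gain_threshold G
          \<and> push_period l b p cf ca \<in> \<nat> \<longrightarrow> 1 < zero_gain_threshold G)"
proof -
  have "0 < G"
    using assms by simp
  define f where "f = zero_gain_threshold G"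
  have "f \<in> zero_gain_points G"
    unfolding f_def zero_gain_threshold_def by (rule theI'[OF ex1_zero_gain_point[OF \<open>0 < G\<close>]])
  then have f: "0 < f" "f < 2" "balance_gain (f / 2) = G"
    by (simp_all add: mem_zero_gain_points_iff[OF \<open>0 < G\<close>])
  have "1 < f" if "9 / 8 < G"
  proof (rule ccontr)
    have half: "balance_gain (1 / 2) = 9 / 8"
      by (simp add: balance_gain_def power2_eq_square)
    assume "\<not> 1 < f"
    then have "f < 1 \<or> f = 1"
      by auto
    then have "balance_gain (f / 2) \<le> 9 / 8"
      using balance_gain_strict_mono[of "f / 2" "1 / 2"] f(1) half by auto
    then show False
      using that f(3) by simp
  qed
  moreover have "1 < f"
    if adm: "admissible l b p cf ca" and bp: "b * p / l = f"
      and int: "push_period l b p cf ca \<in> \<nat>" for l b p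
  proof -
    have F: "b * p / (2 * l) = f / 2"
      using bp by auto
    have period: "push_period l b p cf ca = (2 - f / 2) / (4 * (1 - f / 2))"
      using push_period_balance_gain[OF adm] f assms(3) unfolding F by simp
    then have "0 < push_period l b p cf ca"
      using f by simp
    \<comment> \<open>A positive natural number is at least \<open>1\<close>; this yields
      \<open>f \<ge> 4 / 3\<close>, more than is claimed.\<close>
    with int have "1 \<le> push_period l b p cf ca"
      by (auto elim!: Nats_cases)
    then have "4 * (1 - f / 2) \<le> 2 - f / 2"
      using f unfolding period by (simp add: le_divide_eq)
    then show ?thesis
      by simp
  qed
  ultimately show ?thesis
    using ex1_zero_gain_point[OF \<open>0 < G\<close>] f(2) unfolding f_def by blast
qed

end
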